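(* Let $d\ge3$, and let $\mathbf f$ and $\mathbf g$ be box-simple vector fields on $\mathbb{R}^d$ with supports contained in some open set $\Omega\subset\mathbb{R}^d$ and $$P_{\Omega^{c}\leftarrow\Omega}(\mathbf f)=P_{\Omega^{c}\leftarrow\Omega}(\mathbf g).$$ Then $\mathbf f=\mathbf g$.
   Context: A vector field $\mathbf f:\mathbb{R}^d\to\mathbb{R}^d$ is box-simple if it has the form $\mathbf f=\sum_{i=1}^N\mathbf v_i\chi_{\omega_i}$ with finitely many vectors $\mathbf v_i\in\mathbb{R}^d$ and bounded rectangular parallelepipeds $\omega_i$ with edges parallel to the coordinate axes ($\chi_A$ is the characteristic function of $A$); vector fields are identified when they agree up to a set of Lebesgue measure zero. $\Omega^c:=\mathbb{R}^d\setminus\overline\Omega$. With $N(x)=\frac{1}{(d-2)\omega_d}|x|^{2-d}$, where $\omega_d$ is the area of the unit sphere in $\mathbb{R}^d$, the magnetic potential of $\mathbf f\in L^2(\Omega;\mathbb{R}^d)$ is $P_{\Omega^c\leftarrow\Omega}(\mathbf f)(x)=\int_\Omega\nabla N(x-y)\cdot\mathbf f(y)\,dy$ for $x\in\Omega^c$.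
   Formalization: The formal statement additionally assumes that Ω^c (the complement of the closure of Ω) is nonempty; without this the claim is false, e.g. for Ω = ℝ^d, f = e₁χ of the unit cube, g = 0, where the potentials agree vacuously on the empty set. *)

theory Defs
  imports "HOL-Analysis.Analysis"
begin

text \<open>
  Vector fields are functions \<open>real ^ 'n \<Rightarrow> real ^ 'n\<close>, identified when they agree
  Lebesgue-almost everywhere; every notion below is invariant under this identification.
\<close>

text \<open>
  Which boundary faces belong to a parallelepiped is irrelevant up to a null set, so closed
  boxes with nonempty interior suffice.
\<close>

definition box_simple :: "(real ^ 'n \<Rightarrow> real ^ 'n) \<Rightarrow> bool" where
  "box_simple f \<longleftrightarrow>
     (\<exists>(N::nat) (v :: nat \<Rightarrow> real ^ 'n) (a :: nat \<Rightarrow> real ^ 'n) (b :: nat \<Rightarrow> real ^ 'n).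
        (\<forall>i<N. box (a i) (b i) \<noteq> {}) \<and>
        (AE x in lebesgue. f x = (\<Sum>i<N. indicat_real (cbox (a i) (b i)) x *\<^sub>R v i)))"

text \<open>
  The support of an almost-everywhere equivalence class: the complement of the largest open
  set on which the field vanishes almost everywhere.
\<close>

definition ess_support :: "(real ^ 'n \<Rightarrow> real ^ 'n) \<Rightarrow> (real ^ 'n) set" where
  "ess_support f = - \<Union>{U. open U \<and> (AE x in lebesgue. x \<in> U \<longrightarrow> f x = 0)}"

definition exterior_of :: "(real ^ 'n) set \<Rightarrow> (real ^ 'n) set" where
  "exterior_of \<Omega> = - closure \<Omega>"

text \<open>
  The classical closed formula for the area of the unit sphere in dimension \<open>d\<close>; it equals
  the derivative at radius 1 of the volume of the ball, as shown in \<open>sphere_area_content\<close>.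
\<close>

definition sphere_area :: "nat \<Rightarrow> real" where
  "sphere_area d = 2 * pi powr (real d / 2) / Gamma (real d / 2)"

lemma sphere_area_unit_ball_vol:
  assumes "d \<ge> 1"
  shows "sphere_area d = real d * unit_ball_vol (real d)"
proof -
  have "real d / 2 \<notin> \<int>\<^sub>\<le>\<^sub>0"
    using assms by (auto elim!: nonpos_Ints_cases)
  then have "Gamma (real d / 2 + 1) = real d / 2 * Gamma (real d / 2)"
    by (rule Gamma_plus1)
  then show ?thesis
    unfolding sphere_area_def unit_ball_vol_def using assms by (simp only:) simp
qed

lemma sphere_area_content:
  "((\<lambda>r. measure lebesgue (ball (0 :: real ^ 'n) r))
      has_real_derivative sphere_area CARD('n)) (at 1)"
proof -
  have eq: "measure lebesgue (ball (0 :: real ^ 'n) r) = unit_ball_vol CARD('n) * r ^ CARD('n)"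
    if "r > 0" for r
    using content_ball[of r "0 :: real ^ 'n"] that by (simp add: measure_completion)
  have "CARD('n) \<ge> 1"
    by (simp add: Suc_leI)
  then have d: "((\<lambda>r. unit_ball_vol CARD('n) * r ^ CARD('n))
               has_real_derivative sphere_area CARD('n)) (at 1)"
    by (auto intro!: derivative_eq_intros simp: sphere_area_unit_ball_vol)
  show ?thesis
    by (rule has_field_derivative_transform_within_open[OF d, where S = "{0<..}"])
       (use eq in auto)
qed

definition newton_kernel :: "real ^ 'n \<Rightarrow> real" where
  "newton_kernel x =
     1 / ((real CARD('n) - 2) * sphere_area CARD('n)) * norm x powr (2 - real CARD('n))"

definition gradient :: "(real ^ 'n \<Rightarrow> real) \<Rightarrow> real ^ 'n \<Rightarrow> real ^ 'n" where
  "gradient \<phi> x = (THE D. GDERIV \<phi> x :> D)"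

lemma gradient_eqI:
  assumes "GDERIV \<phi> x :> D"
  shows "gradient \<phi> x = D"
  unfolding gradient_def
proof (rule the_equality)
  show "GDERIV \<phi> x :> D" by (fact assms)
next
  fix E assume "GDERIV \<phi> x :> E"
  then have "(\<lambda>h. h \<bullet> E) = (\<lambda>h. h \<bullet> D)"
    using assms unfolding gderiv_def by (rule has_derivative_unique)
  then have "h \<bullet> E = h \<bullet> D" for h
    by (rule fun_cong)
  then show "E = D"
    by (metis inner_commute vector_eq_ldot)
qed

lemma gradient_newton_kernel:
  fixes x :: "real ^ 'n"
  assumes "CARD('n) \<ge> 3" and "x \<noteq> 0"
  shows "gradient newton_kernel x =
           (- (norm x powr (- real CARD('n)) / sphere_area CARD('n))) *\<^sub>R x"
proof (rule gradient_eqI)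
  let ?d = "real CARD('n)"
  let ?c = "1 / ((?d - 2) * sphere_area CARD('n))"
  have "((\<lambda>t. t powr (2 - ?d)) has_real_derivative
          (2 - ?d) * norm x powr (2 - ?d - 1)) (at (norm x))"
    using assms(2) by (intro has_real_derivative_powr) simp
  then have "((\<lambda>t. ?c * t powr (2 - ?d)) has_real_derivative
          ?c * ((2 - ?d) * norm x powr (1 - ?d))) (at (norm x))"
    by (intro DERIV_cmult) (simp add: algebra_simps)
  from GDERIV_DERIV_compose[OF GDERIV_norm[OF assms(2)] this]
  have "GDERIV newton_kernel x :> (?c * ((2 - ?d) * norm x powr (1 - ?d))) *\<^sub>R sgn x"
    unfolding newton_kernel_def[abs_def] by simp
  moreover have "?c * ((2 - ?d) * norm x powr (1 - ?d)) =
      - (norm x powr (1 - ?d) / sphere_area CARD('n))"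
  proof -
    have "?d - 2 \<noteq> 0" using assms(1) by auto
    then show ?thesis
      by (simp add: divide_simps) (simp add: algebra_simps)
  qed
  moreover have "(- (norm x powr (1 - ?d) / sphere_area CARD('n))) *\<^sub>R sgn x =
      (- (norm x powr (- ?d) / sphere_area CARD('n))) *\<^sub>R x"
    using assms(2) by (simp add: sgn_div_norm powr_diff powr_minus divide_simps)
  ultimately show "GDERIV newton_kernel x :>
      (- (norm x powr (- ?d) / sphere_area CARD('n))) *\<^sub>R x"
    by simp
qed

text \<open>
  Only meaningful for \<open>x \<in> exterior_of \<Omega>\<close>. Note that \<open>exterior_of \<Omega>\<close> is empty when \<open>\<Omega>\<close> is dense,
  in which case equality of two potentials there carries no information.
\<close>

definition magnetic_potential ::
    "(real ^ 'n) set \<Rightarrow> (real ^ 'n \<Rightarrow> real ^ 'n) \<Rightarrow> real ^ 'n \<Rightarrow> real" where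
  "magnetic_potential \<Omega> f x =
     (LINT y|lebesgue_on \<Omega>. gradient newton_kernel (x - y) \<bullet> f y)"

end

theory Submission
  imports Defs "HOL-Complex_Analysis.Conformal_Mappings"
begin

text \<open>
  The indicator of a box is an alternating sum, over its \<open>2 ^ d\<close> corners, of indicators of
  orthants. A box-simple field is therefore, almost everywhere, a finite sum
  \<open>\<Sum>p\<in>P. indicator (orthant p) *\<^sub>R w p\<close>, in which the vectors \<open>w p\<close> determine the field.
  Formally, the mixed derivative \<open>\<partial>\<^sub>1 \<dots> \<partial>\<^sub>d\<close> turns the indicator of an orthant into a point mass at
  its corner, so it turns the potential of the field into the potential
  \<open>\<Sum>p\<in>P. dipole (x - p) \<bullet> w p\<close> of finitely many point dipoles, up to a constant factor.
  Two fields with the same potential on the nonempty open exterior thus have the same dipole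
  potential on a nonempty open set.

  Dipoles at distinct points are linearly independent over any nonempty open set
  (\<open>dipole_sum_eq_0_imp\<close>): a dipole sum is real analytic away from the points \<open>p\<close>, so if it
  vanishes on an open set, it vanishes along the segments from there towards a point \<open>p\<close> that meet
  no other corner; but a nonzero dipole at \<open>p\<close> makes it blow up along almost all of these segments.
  Hence all the vectors \<open>w p\<close> of the two fields agree, and so do the fields.

  The mixed derivative is taken as a limit of mixed difference quotients
  (\<open>mixed_difference_quotient_tendsto\<close>). Differencing can be moved from the kernel to the
  field by translation invariance, and there it produces exactly the indicators of small cells at
  the corners, so no differentiation under the integral sign is needed, and singularities of the
  kernel inside the support cause no trouble.
\<close>

section \<open>Box-simple fields as sums over corners\<close>

definition orthant :: "real ^ 'n \<Rightarrow> (real ^ 'n) set" where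
  "orthant p = {y. \<forall>i. p $ i \<le> y $ i}"

text \<open>
  Half-open boxes make the inclusion-exclusion formula over corners hold at every point, not only
  almost everywhere.
\<close>

definition half_open_box :: "real ^ 'n \<Rightarrow> real ^ 'n \<Rightarrow> (real ^ 'n) set" where
  "half_open_box a b = {y. \<forall>i. a $ i \<le> y $ i \<and> y $ i < b $ i}"

text \<open>
  The corner of the box from \<open>a\<close> to \<open>b\<close> that takes its coordinates in \<open>X\<close> from \<open>b\<close>. With
  \<open>a = vec s\<close> and \<open>b = 0\<close> these are the shift vectors of a mixed difference with step \<open>s\<close>.
\<close>

definition corner :: "real ^ 'n \<Rightarrow> real ^ 'n \<Rightarrow> 'n set \<Rightarrow> real ^ 'n" where
  "corner a b X = (\<chi> i. if i \<in> X then b $ i else a $ i)"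

definition corner_sum ::
    "(real ^ 'n) set \<Rightarrow> (real ^ 'n \<Rightarrow> real ^ 'n) \<Rightarrow> real ^ 'n \<Rightarrow> real ^ 'n" where
  "corner_sum P w y = (\<Sum>p\<in>P. indicat_real (orthant p) y *\<^sub>R w p)"

text \<open>
  Up to the factor \<open>- 1 / sphere_area d\<close> this is the gradient of the Newton kernel. Its value at
  the origin is 0, which makes it a Borel function on the whole space.
\<close>

definition dipole :: "real ^ 'n \<Rightarrow> real ^ 'n" where
  "dipole z = (norm z powr - real CARD('n)) *\<^sub>R z"

text \<open>
  In one dimension the indicator of \<open>{a..<b}\<close> is the indicator of \<open>{a..}\<close> minus that of \<open>{b..}\<close>;
  multiplying out the product of these differences over all coordinates gives the sum over corners.
\<close>

lemma indicator_half_open_box: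
  fixes a b :: "real ^ 'n"
  assumes "\<And>i. a $ i \<le> b $ i"
  shows "indicat_real (half_open_box a b) y =
    (\<Sum>X\<in>UNIV. (-1) ^ card X * indicat_real (orthant (corner a b X)) y)"
proof -
  have "indicat_real (half_open_box a b) y =
      (\<Prod>i\<in>UNIV. of_bool (a $ i \<le> y $ i) - of_bool (b $ i \<le> y $ i))"
  proof (cases "y \<in> half_open_box a b")
    case True
    then have "of_bool (a $ i \<le> y $ i) - of_bool (b $ i \<le> y $ i) = (1::real)" for i
      by (auto simp: half_open_box_def not_le)
    then show ?thesis using True by simp
  next
    case False
    then obtain i where "\<not> (a $ i \<le> y $ i \<and> y $ i < b $ i)"
      by (auto simp: half_open_box_def)
    then have "of_bool (a $ i \<le> y $ i) - of_bool (b $ i \<le> y $ i) = (0::real)"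
      using assms[of i] by (auto simp: of_bool_def)
    then have "\<exists>i\<in>UNIV. of_bool (a $ i \<le> y $ i) - of_bool (b $ i \<le> y $ i) = (0::real)" by blast
    then have "(\<Prod>i\<in>UNIV. of_bool (a $ i \<le> y $ i) - of_bool (b $ i \<le> y $ i)) = (0::real)"
      by (intro prod_zero) simp_all
    then show ?thesis using False by simp
  qed
  also have "\<dots> = (\<Sum>X\<in>Pow UNIV. (-1) ^ card X * (\<Prod>i\<in>X. of_bool (b $ i \<le> y $ i)) *
      (\<Prod>i\<in>UNIV - X. of_bool (a $ i \<le> y $ i)))"
    by (rule prod_diff_conv_sum) simp
  also have "\<dots> = (\<Sum>X\<in>UNIV. (-1) ^ card X * indicat_real (orthant (corner a b X)) y)"
  proof (rule sum.cong)
    fix X :: "'n set"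
    have "indicat_real (orthant (corner a b X)) y =
        (\<Prod>i\<in>UNIV. of_bool (corner a b X $ i \<le> y $ i))"
      by (auto simp: orthant_def indicator_def prod_zero_iff)
    also have "\<dots> = (\<Prod>i\<in>X. of_bool (corner a b X $ i \<le> y $ i)) *
        (\<Prod>i\<in>UNIV - X. of_bool (corner a b X $ i \<le> y $ i))"
      by (subst prod.subset_diff[of X UNIV]) (auto simp: mult.commute)
    also have "\<dots> = (\<Prod>i\<in>X. of_bool (b $ i \<le> y $ i)) *
        (\<Prod>i\<in>UNIV - X. of_bool (a $ i \<le> y $ i))"
      by (intro arg_cong2[where f="(*)"] prod.cong) (auto simp: corner_def)
    finally show "(-1) ^ card X * (\<Prod>i\<in>X. of_bool (b $ i \<le> y $ i)) *
        (\<Prod>i\<in>UNIV - X. of_bool (a $ i \<le> y $ i)) =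
        (-1) ^ card X * indicat_real (orthant (corner a b X)) y"
      by simp
  qed simp
  finally show ?thesis .
qed

lemma orthant_borel [measurable]: "orthant p \<in> sets borel"
proof -
  have "closed (orthant p)"
    unfolding orthant_def by (intro closed_Collect_all closed_Collect_le continuous_intros)
  then show ?thesis by simp
qed

lemma half_open_box_borel [measurable]: "half_open_box a b \<in> sets borel"
proof -
  have "half_open_box a b = (\<Inter>i. {y. a $ i \<le> y $ i} \<inter> {y. y $ i < b $ i})"
    by (auto simp: half_open_box_def)
  also have "\<dots> \<in> sets borel"
    by (intro sets.finite_INT sets.Int borel_closed borel_open closed_Collect_le open_Collect_less
        continuous_intros) auto
  finally show ?thesis .
qed

lemma AE_half_open_box_iff_cbox:
  fixes a b :: "real ^ 'n"
  shows "AE y in lebesgue. y \<in> half_open_box a b \<longleftrightarrow> y \<in> cbox a b"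
proof -
  have "AE y in lebesgue. y \<notin> cbox a b - box a b"
    using negligible_frontier_interval[of a b]
    by (intro AE_not_in) (simp add: negligible_iff_null_sets)
  then show ?thesis
    by eventually_elim (auto simp: half_open_box_def mem_box_cart less_imp_le)
qed

text \<open>
  The weight of a point collects the contributions of all boxes that have it as a corner. Weights
  are 0 outside \<open>P\<close>, so that \<open>P\<close> can be enlarged freely; this allows two fields to share
  the same set of corners.
\<close>

lemma box_simple_corner_sum:
  fixes f :: "real ^ 'n \<Rightarrow> real ^ 'n"
  assumes "box_simple f"
  obtains P w where "finite P" "\<And>p. p \<notin> P \<Longrightarrow> w p = 0"
    "AE y in lebesgue. f y = corner_sum P w y"
proof -
  obtain N :: nat and v a b where ne: "\<And>i. i < N \<Longrightarrow> box (a i) (b i) \<noteq> {}"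
    and f: "AE y in lebesgue. f y = (\<Sum>i<N. indicat_real (cbox (a i) (b i)) y *\<^sub>R v i)"
    using assms unfolding box_simple_def by blast
  let ?J = "{..<N} \<times> (UNIV :: 'n set set)"
  let ?c = "\<lambda>(i, X). corner (a i) (b i) X"
  let ?v = "\<lambda>(i, X). (-1) ^ card X *\<^sub>R v i"
  define w where "w p = sum ?v {j \<in> ?J. ?c j = p}" for p
  have w0: "w p = 0" if "p \<notin> ?c ` ?J" for p
  proof -
    have none: "{j \<in> ?J. ?c j = p} = {}" using that by blast
    show ?thesis unfolding w_def none by simp
  qed
  have "AE y in lebesgue. \<forall>i\<in>{..<N}. y \<in> half_open_box (a i) (b i) \<longleftrightarrow> y \<in> cbox (a i) (b i)"
    by (intro AE_finite_allI AE_half_open_box_iff_cbox) auto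
  with f have "AE y in lebesgue. f y = corner_sum (?c ` ?J) w y"
  proof eventually_elim
    case (elim y)
    have "f y = (\<Sum>i<N. indicat_real (half_open_box (a i) (b i)) y *\<^sub>R v i)"
      unfolding elim(1) using elim(2) by (intro sum.cong) (auto simp: indicator_def)
    also have "\<dots> = (\<Sum>i<N. (\<Sum>X\<in>UNIV.
        (-1) ^ card X * indicat_real (orthant (corner (a i) (b i) X)) y) *\<^sub>R v i)"
    proof (rule sum.cong)
      fix i assume "i \<in> {..<N}"
      then have "a i $ k \<le> b i $ k" for k
        using ne[of i] by (auto simp: interval_ne_empty_cart less_imp_le)
      then show "indicat_real (half_open_box (a i) (b i)) y *\<^sub>R v i = (\<Sum>X\<in>UNIV.
        (-1) ^ card X * indicat_real (orthant (corner (a i) (b i) X)) y) *\<^sub>R v i"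
        by (simp add: indicator_half_open_box)
    qed simp
    also have "\<dots> = (\<Sum>j\<in>?J. indicat_real (orthant (?c j)) y *\<^sub>R ?v j)"
      unfolding scaleR_sum_left sum.cartesian_product
      by (intro sum.cong) (auto simp: mult.commute)
    also have "\<dots> = (\<Sum>p\<in>?c ` ?J.
        \<Sum>j\<in>{j \<in> ?J. ?c j = p}. indicat_real (orthant (?c j)) y *\<^sub>R ?v j)"
      by (rule sum.image_gen) simp
    also have "\<dots> = (\<Sum>p\<in>?c ` ?J. indicat_real (orthant p) y *\<^sub>R w p)"
      unfolding w_def by (intro sum.cong refl) (simp add: scaleR_sum_right)
    finally show ?case by (simp add: corner_sum_def)
  qed
  then show ?thesis using that[of "?c ` ?J" w] w0 by simp
qed

lemma corner_sum_borel [measurable]: "corner_sum P w \<in> borel_measurable borel"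
  unfolding corner_sum_def[abs_def] by measurable

lemma dipole_borel [measurable]: "dipole \<in> borel_measurable borel"
  unfolding dipole_def[abs_def] by measurable

lemma isCont_dipole: "z \<noteq> 0 \<Longrightarrow> isCont dipole z"
  unfolding dipole_def[abs_def] by (intro continuous_intros) auto

section \<open>Mixed differences of the potential\<close>

text \<open>
  Translating an orthant back by the shift vectors gives the orthants at the corners of a cell of side
  \<open>s\<close> whose upper corner is \<open>p\<close>. The mixed difference of its indicator is
  then the corner expansion of the indicator of that cell.
\<close>

lemma mixed_difference_corner_sum:
  fixes P :: "(real ^ 'n) set"
  assumes "s \<ge> 0"
  shows "(\<Sum>X\<in>UNIV. (-1) ^ card X *\<^sub>R corner_sum P w (y + corner (vec s) 0 X)) =
    (\<Sum>p\<in>P. indicat_real (half_open_box (p - vec s) p) y *\<^sub>R w p)"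
proof -
  have shift: "indicat_real (orthant p) (y + corner (vec s) 0 X) =
      indicat_real (orthant (corner (p - vec s) p X)) y" for p X
    by (auto simp: indicator_def orthant_def corner_def split: if_splits)
       (metis add.commute add_0 diff_le_eq)+
  have "(\<Sum>X\<in>UNIV. (-1) ^ card X *\<^sub>R corner_sum P w (y + corner (vec s) 0 X)) =
      (\<Sum>p\<in>P. (\<Sum>X\<in>UNIV. (-1) ^ card X *
        indicat_real (orthant (corner (p - vec s) p X)) y) *\<^sub>R w p)"
    unfolding corner_sum_def shift scaleR_sum_right scaleR_sum_left
    by (subst sum.swap) simp
  also have "\<dots> = (\<Sum>p\<in>P. indicat_real (half_open_box (p - vec s) p) y *\<^sub>R w p)"
    using assms by (intro sum.cong refl) (simp add: indicator_half_open_box)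
  finally show ?thesis .
qed

lemma shifted_corners_in_ball:
  fixes x :: "real ^ 'n"
  assumes "r > 0"
  shows "\<forall>\<^sub>F s in at_right 0. s > 0 \<and> (\<forall>X. x + corner (vec s) 0 X \<in> ball x r)"
proof -
  have "\<forall>\<^sub>F s::real in at_right 0. s > 0 \<and> s < r / real CARD('n)"
    using assms by (intro eventually_conj eventually_at_right_less order_tendstoD(2)[OF tendsto_ident_at]) simp
  then show ?thesis
  proof eventually_elim
    case (elim s)
    have "x + corner (vec s) 0 X \<in> ball x r" for X
    proof -
      let ?t = "corner (vec s) 0 X :: real ^ 'n"
      have "norm ?t \<le> (\<Sum>i\<in>UNIV. \<bar>?t $ i\<bar>)" by (rule norm_le_l1_cart)
      also have "\<dots> \<le> (\<Sum>i\<in>(UNIV::'n set). s)"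
        using elim by (intro sum_mono) (auto simp: corner_def)
      also have "\<dots> < r" using elim by (simp add: field_simps)
      finally show ?thesis by (simp add: dist_norm)
    qed
    then show ?case using elim by blast
  qed
qed

lemma cell_average_tendsto:
  fixes \<phi> :: "real ^ 'n \<Rightarrow> real"
  assumes [measurable]: "\<phi> \<in> borel_measurable borel" and "isCont \<phi> p"
  shows "\<forall>\<^sub>F s in at_right 0.
      integrable lborel (\<lambda>y. indicat_real (half_open_box (p - vec s) p) y * \<phi> y)"
    and "((\<lambda>s. (LINT y|lborel. indicat_real (half_open_box (p - vec s) p) y * \<phi> y) / s ^ CARD('n))
      \<longlongrightarrow> \<phi> p) (at_right 0)"
proof -
  have main: "\<exists>\<delta>>0. \<forall>s. 0 < s \<and> s < \<delta> \<longrightarrow>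
      integrable lborel (\<lambda>y. indicat_real (half_open_box (p - vec s) p) y * \<phi> y) \<and>
      \<bar>(LINT y|lborel. indicat_real (half_open_box (p - vec s) p) y * \<phi> y) / s ^ CARD('n) - \<phi> p\<bar> \<le> e"
    if "e > 0" for e
  proof -
    from \<open>isCont \<phi> p\<close> \<open>e > 0\<close> obtain r where r: "r > 0" "\<And>y. dist y p < r \<Longrightarrow> dist (\<phi> y) (\<phi> p) < e"
      unfolding continuous_at by (metis LIM_def dist_self)
    define \<delta> where "\<delta> = r / real CARD('n)"
    have "\<delta> > 0" using r by (simp add: \<delta>_def)
    moreover have "integrable lborel (\<lambda>y. indicat_real (half_open_box (p - vec s) p) y * \<phi> y) \<and>
        \<bar>(LINT y|lborel. indicat_real (half_open_box (p - vec s) p) y * \<phi> y) / s ^ CARD('n) - \<phi> p\<bar> \<le> e"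
      if s: "0 < s" "s < \<delta>" for s
    proof -
      let ?C = "half_open_box (p - vec s) p"
      have close: "\<bar>\<phi> y - \<phi> p\<bar> \<le> e" if "y \<in> ?C" for y
      proof -
        have "norm (y - p) \<le> (\<Sum>i\<in>UNIV. \<bar>(y - p) $ i\<bar>)" by (rule norm_le_l1_cart)
        also have "\<dots> \<le> (\<Sum>i\<in>(UNIV::'n set). s)"
        proof (rule sum_mono)
          fix i :: 'n
          have "p $ i - s \<le> y $ i \<and> y $ i < p $ i" using that by (simp add: half_open_box_def)
          then show "\<bar>(y - p) $ i\<bar> \<le> s" by auto
        qed
        also have "\<dots> < r" using s by (simp add: \<delta>_def field_simps)
        finally show ?thesis using r(2)[of y] by (simp add: dist_norm less_imp_le)
      qed
      have AEeq: "AE y in lborel. y \<in> ?C \<longleftrightarrow> y \<in> cbox (p - vec s) p"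
        using AE_half_open_box_iff_cbox[of "p - vec s" p] by (simp add: AE_completion_iff)
      have em: "emeasure lborel ?C = emeasure lborel (cbox (p - vec s) p)"
        using AEeq by (intro emeasure_eq_AE) auto
      then have fin: "emeasure lborel ?C < \<infinity>"
        using emeasure_lborel_cbox_finite by metis
      have "cbox (p - vec s) p \<noteq> {}"
        using s by (simp add: interval_ne_empty_cart)
      then have meas: "measure lborel ?C = s ^ CARD('n)"
        using em by (simp add: measure_def content_cbox_cart[unfolded measure_def])
      have ind: "integrable lborel (indicat_real ?C)" using fin by simp
      have "norm (\<phi> y) \<le> \<bar>\<phi> p\<bar> + e" if "y \<in> ?C" for y
        using close[OF that] by simp
      then have int: "integrable lborel (\<lambda>y. indicat_real ?C y * \<phi> y)"
        using integrableI_bounded_set_indicator[of ?C lborel \<phi> "\<bar>\<phi> p\<bar> + e"] fin by simp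
      have "\<bar>(LINT y|lborel. indicat_real ?C y * \<phi> y) - \<phi> p * s ^ CARD('n)\<bar> =
          \<bar>LINT y|lborel. indicat_real ?C y * \<phi> y - indicat_real ?C y * \<phi> p\<bar>"
        using int ind meas by (subst Bochner_Integration.integral_diff) (auto simp: mult.commute)
      also have "\<dots> \<le> (LINT y|lborel. \<bar>indicat_real ?C y * \<phi> y - indicat_real ?C y * \<phi> p\<bar>)"
        by (rule integral_abs_bound)
      also have "\<dots> \<le> (LINT y|lborel. indicat_real ?C y * e)"
      proof (rule integral_mono)
        show "integrable lborel (\<lambda>y. \<bar>indicat_real ?C y * \<phi> y - indicat_real ?C y * \<phi> p\<bar>)"
          using int ind by (intro integrable_abs Bochner_Integration.integrable_diff
              integrable_mult_left) auto
        show "integrable lborel (\<lambda>y. indicat_real ?C y * e)"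
          using ind by (intro integrable_mult_left) auto
      qed (use close in \<open>auto simp: indicator_def\<close>)
      also have "\<dots> = e * s ^ CARD('n)" using meas by simp
      finally have le: "\<bar>(LINT y|lborel. indicat_real ?C y * \<phi> y) - \<phi> p * s ^ CARD('n)\<bar>
          \<le> e * s ^ CARD('n)" .
      have "\<bar>(LINT y|lborel. indicat_real ?C y * \<phi> y) / s ^ CARD('n) - \<phi> p\<bar> =
          \<bar>(LINT y|lborel. indicat_real ?C y * \<phi> y) - \<phi> p * s ^ CARD('n)\<bar> / s ^ CARD('n)"
        using s by (simp add: field_simps abs_divide flip: abs_mult)
      also have "\<dots> \<le> e" using le s by (simp add: divide_le_eq)
      finally show ?thesis using int by simp
    qed
    ultimately show ?thesis by blast
  qed
  have ev: "\<forall>\<^sub>F s in at_right 0.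
      integrable lborel (\<lambda>y. indicat_real (half_open_box (p - vec s) p) y * \<phi> y) \<and>
      \<bar>(LINT y|lborel. indicat_real (half_open_box (p - vec s) p) y * \<phi> y) / s ^ CARD('n) - \<phi> p\<bar> \<le> e"
    if "e > 0" for e
    using main[OF that] unfolding eventually_at_right_field by blast
  from ev[OF zero_less_one] show "\<forall>\<^sub>F s in at_right 0.
      integrable lborel (\<lambda>y. indicat_real (half_open_box (p - vec s) p) y * \<phi> y)"
    by eventually_elim blast
  show "((\<lambda>s. (LINT y|lborel. indicat_real (half_open_box (p - vec s) p) y * \<phi> y) / s ^ CARD('n))
      \<longlongrightarrow> \<phi> p) (at_right 0)"
  proof (rule tendstoI)
    fix e :: real assume "e > 0"
    then have "e / 2 > 0" by simp
    from ev[OF this] show "\<forall>\<^sub>F s in at_right 0. dist ((LINT y|lborel.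
        indicat_real (half_open_box (p - vec s) p) y * \<phi> y) / s ^ CARD('n)) (\<phi> p) < e"
      by eventually_elim (use \<open>e > 0\<close> in \<open>simp add: dist_real_def\<close>)
  qed
qed

text \<open>
  Integrability is required of the whole integrand only, not of the summands belonging to single
  corners: the orthants are unbounded and may contain \<open>x\<close>, but the differenced summands live on
  small cells away from \<open>x\<close>.
\<close>

lemma mixed_difference_quotient_tendsto:
  fixes x :: "real ^ 'n"
  assumes "finite P" "x \<notin> P" "r > 0"
    and int: "\<And>x'. x' \<in> ball x r \<Longrightarrow> integrable lborel (\<lambda>y. dipole (x' - y) \<bullet> corner_sum P w y)"
  shows "((\<lambda>s. (\<Sum>X\<in>UNIV. (-1) ^ card X *
      (LINT y|lborel. dipole (x + corner (vec s) 0 X - y) \<bullet> corner_sum P w y)) / s ^ CARD('n))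
    \<longlongrightarrow> (\<Sum>p\<in>P. dipole (x - p) \<bullet> w p)) (at_right 0)"
proof -
  let ?C = "\<lambda>s p. half_open_box (p - vec s) p"
  have cont: "isCont (\<lambda>y. dipole (x - y) \<bullet> w p) p" if "p \<in> P" for p
  proof -
    have "x - p \<noteq> 0" using that \<open>x \<notin> P\<close> by auto
    then have "isCont dipole (x - p)" by (rule isCont_dipole)
    then have "isCont (\<lambda>y. dipole (x - y)) p"
      using isCont_o2[of p "\<lambda>y. x - y" dipole] by simp
    then show ?thesis by (intro continuous_intros)
  qed
  have "((\<lambda>s. \<Sum>p\<in>P. (LINT y|lborel. indicat_real (?C s p) y * (dipole (x - y) \<bullet> w p)) / s ^ CARD('n))
      \<longlongrightarrow> (\<Sum>p\<in>P. dipole (x - p) \<bullet> w p)) (at_right 0)"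
    by (intro tendsto_sum cell_average_tendsto cont) auto
  moreover have "\<forall>\<^sub>F s in at_right 0.
      (\<Sum>p\<in>P. (LINT y|lborel. indicat_real (?C s p) y * (dipole (x - y) \<bullet> w p)) / s ^ CARD('n)) =
      (\<Sum>X\<in>UNIV. (-1) ^ card X *
        (LINT y|lborel. dipole (x + corner (vec s) 0 X - y) \<bullet> corner_sum P w y)) / s ^ CARD('n)"
  proof -
    have "\<forall>\<^sub>F s in at_right 0. \<forall>p\<in>P.
        integrable lborel (\<lambda>y. indicat_real (?C s p) y * (dipole (x - y) \<bullet> w p))"
      using \<open>finite P\<close> by (intro eventually_ball_finite ballI cell_average_tendsto cont) auto
    moreover note shifted_corners_in_ball[OF \<open>r > 0\<close>, of x]
    ultimately show ?thesis
    proof eventually_elim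
      case (elim s)
      let ?t = "\<lambda>X. corner (vec s) 0 X :: real ^ 'n"
      \<comment> \<open>A shift of the evaluation point is a shift of the field, by translation invariance.\<close>
      have shifted: "integrable lborel (\<lambda>y. dipole (x - y) \<bullet> corner_sum P w (y + ?t X))"
          "(LINT y|lborel. dipole (x + ?t X - y) \<bullet> corner_sum P w y) =
           (LINT y|lborel. dipole (x - y) \<bullet> corner_sum P w (y + ?t X))" for X
      proof -
        let ?F = "\<lambda>y. dipole (x + ?t X - y) \<bullet> corner_sum P w y"
        have F: "?F \<in> borel_measurable borel" by measurable
        have eq: "?F (?t X + y) = dipole (x - y) \<bullet> corner_sum P w (y + ?t X)" for y
          by (simp add: algebra_simps)
        have "integrable (distr lborel borel ((+) (?t X))) ?F"
          using int elim by (simp add: lborel_distr_plus)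
        then show "integrable lborel (\<lambda>y. dipole (x - y) \<bullet> corner_sum P w (y + ?t X))"
          using F by (subst (asm) integrable_distr_eq) (auto simp only: eq, measurable)
        have "(LINT y|lborel. ?F y) = integral\<^sup>L (distr lborel borel ((+) (?t X))) ?F"
          by (simp add: lborel_distr_plus)
        also have "\<dots> = (LINT y|lborel. ?F (?t X + y))"
          using F by (intro integral_distr) auto
        finally show "(LINT y|lborel. ?F y) =
            (LINT y|lborel. dipole (x - y) \<bullet> corner_sum P w (y + ?t X))"
          by (simp only: eq)
      qed
      have "(\<Sum>X\<in>UNIV. (-1) ^ card X *
            (LINT y|lborel. dipole (x + ?t X - y) \<bullet> corner_sum P w y)) =
          (LINT y|lborel. (\<Sum>X\<in>UNIV. (-1) ^ card X * (dipole (x - y) \<bullet> corner_sum P w (y + ?t X))))"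
        unfolding shifted(2) using shifted(1)
        by (subst Bochner_Integration.integral_sum) auto
      also have "\<dots> = (LINT y|lborel. dipole (x - y) \<bullet>
          (\<Sum>X\<in>UNIV. (-1) ^ card X *\<^sub>R corner_sum P w (y + ?t X)))"
        by (simp add: inner_sum_right)
      also have "\<dots> = (LINT y|lborel. (\<Sum>p\<in>P. indicat_real (?C s p) y * (dipole (x - y) \<bullet> w p)))"
        using elim by (subst mixed_difference_corner_sum) (auto simp: inner_sum_right)
      also have "\<dots> = (\<Sum>p\<in>P. (LINT y|lborel. indicat_real (?C s p) y * (dipole (x - y) \<bullet> w p)))"
        using elim by (intro Bochner_Integration.integral_sum) auto
      finally show ?case by (simp add: sum_divide_distrib)
    qed
  qed
  ultimately show ?thesis by (rule Lim_transform_eventually)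
qed

section \<open>Linear independence of point dipoles\<close>

lemma line_avoiding_origin_bounded_away:
  fixes c v :: "'a :: real_inner"
  assumes "\<And>a. c + a *\<^sub>R v \<noteq> 0"
  shows "\<exists>e>0. \<forall>a. e \<le> (norm (c + a *\<^sub>R v))\<^sup>2"
proof (cases "v = 0")
  case True
  then show ?thesis using assms[of 0] by (intro exI[of _ "(norm c)\<^sup>2"]) auto
next
  case False
  define a0 where "a0 = - (c \<bullet> v) / (v \<bullet> v)"
  have "(norm (c + a0 *\<^sub>R v))\<^sup>2 \<le> (norm (c + a *\<^sub>R v))\<^sup>2" for a
  proof -
    have "(c + a0 *\<^sub>R v) \<bullet> v = 0"
      using False by (simp add: a0_def inner_left_distrib inner_diff_left)
    moreover have "c + a *\<^sub>R v = (c + a0 *\<^sub>R v) + (a - a0) *\<^sub>R v"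
      by (simp add: algebra_simps)
    ultimately have "(norm (c + a *\<^sub>R v))\<^sup>2 = (norm (c + a0 *\<^sub>R v))\<^sup>2 + (norm ((a - a0) *\<^sub>R v))\<^sup>2"
      by (metis norm_add_Pythagorean orthogonal_clauses(2) orthogonal_def)
    then show ?thesis by simp
  qed
  then show ?thesis using assms[of a0] by (intro exI[of _ "(norm (c + a0 *\<^sub>R v))\<^sup>2"]) auto
qed

text \<open>
  For each \<open>q\<close> a hyperplane through \<open>p\<close> and \<open>q\<close> contains the line through these two points, which is
  to be avoided. Finitely many hyperplanes are negligible and cannot cover an open set.
\<close>

lemma generic_direction:
  fixes p u :: "'a :: euclidean_space"
  assumes "DIM('a) \<ge> 2" "finite Q" "p \<notin> Q" "u \<noteq> 0" "open U" "U \<noteq> {}"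
  obtains x where "x \<in> U" "u \<bullet> (x - p) \<noteq> 0" "\<And>q a. q \<in> Q \<Longrightarrow> p - q + a *\<^sub>R (x - p) \<noteq> 0"
proof -
  have "\<exists>n. n \<noteq> 0 \<and> orthogonal (p - q) n" for q
    using orthogonal_to_vector_exists[OF assms(1), of "p - q"] by blast
  then obtain n where n: "\<And>q. n q \<noteq> 0" "\<And>q. orthogonal (p - q) (n q)" by metis
  let ?B = "{x. u \<bullet> x = u \<bullet> p} \<union> (\<Union>q\<in>Q. {x. n q \<bullet> x = n q \<bullet> p})"
  have "negligible ?B"
    using assms(2,4) n(1) by (intro negligible_Un negligible_Union) (auto intro: negligible_hyperplane)
  moreover have "\<not> negligible U"
    using assms(5,6) open_not_negligible by blast
  ultimately obtain x where x: "x \<in> U" "x \<notin> ?B"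
    using negligible_subset by blast
  have "p - q + a *\<^sub>R (x - p) \<noteq> 0" if "q \<in> Q" for q a
  proof
    assume eq: "p - q + a *\<^sub>R (x - p) = 0"
    have "n q \<bullet> (p - q + a *\<^sub>R (x - p)) = a * (n q \<bullet> x - n q \<bullet> p)"
      using n(2)[of q] by (simp add: orthogonal_def inner_commute inner_right_distrib inner_diff_right)
    then have "a = 0" using eq x(2) that by auto
    then show False using eq that \<open>p \<notin> Q\<close> by auto
  qed
  then show ?thesis using that x by (auto simp: inner_diff_right)
qed

text \<open>
  Along the line \<open>p + a *\<^sub>R v\<close>, the term of \<open>p\<close> is a constant times \<open>a powr (1 - d)\<close>, whereas the other
  terms have no singularity if the line misses the other points. Multiplied by \<open>a ^ (d - 1)\<close>, the
  whole sum extends to a holomorphic function \<open>G\<close> on a strip around the real axis. The function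
  vanishes on real numbers slightly larger than 1, hence on the strip, and its value at 0 is
  the constant belonging to \<open>p\<close>.
\<close>

lemma dipole_sum_eq_0_imp:
  fixes w :: "real ^ 'n \<Rightarrow> real ^ 'n"
  assumes card: "CARD('n) \<ge> 2" and "finite P" "open U" "U \<noteq> {}"
    and zero: "\<And>x. x \<in> U \<Longrightarrow> (\<Sum>p\<in>P. dipole (x - p) \<bullet> w p) = 0"
    and "p \<in> P"
  shows "w p = 0"
proof (rule ccontr)
  assume "w p \<noteq> 0"
  let ?d = "CARD('n)"
  let ?Q = "P - {p}"
  obtain x0 where x0: "x0 \<in> U" "w p \<bullet> (x0 - p) \<noteq> 0"
    and avoid: "\<And>q a. q \<in> ?Q \<Longrightarrow> p - q + a *\<^sub>R (x0 - p) \<noteq> 0"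
    using generic_direction[of ?Q p "w p" U] \<open>w p \<noteq> 0\<close> assms by auto
  define v where "v = x0 - p"
  have "v \<noteq> 0" using x0(2) by (auto simp: v_def)
  have "\<forall>q\<in>?Q. \<exists>e>0. \<forall>a. e \<le> (norm (p - q + a *\<^sub>R v))\<^sup>2"
    using avoid unfolding v_def by (intro ballI line_avoiding_origin_bounded_away) auto
  then obtain e where e: "\<And>q. q \<in> ?Q \<Longrightarrow> e q > 0"
      "\<And>q a. q \<in> ?Q \<Longrightarrow> e q \<le> (norm (p - q + a *\<^sub>R v))\<^sup>2"
    by metis
  \<comment> \<open>A strip so narrow that the complexified squared distances to the other points keep a
    positive real part, where the principal branch of the power is holomorphic.\<close>
  define \<epsilon> where "\<epsilon> = Min (insert 1 (e ` ?Q))"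
  have \<epsilon>: "\<epsilon> > 0" "\<And>q. q \<in> ?Q \<Longrightarrow> \<epsilon> \<le> e q"
    using e(1) \<open>finite P\<close> by (auto simp: \<epsilon>_def)
  define \<delta> where "\<delta> = sqrt \<epsilon> / norm v"
  define S where "S = {z. Im z > - \<delta>} \<inter> {z. Im z < \<delta>}"
  have "\<delta> > 0" using \<epsilon> \<open>v \<noteq> 0\<close> by (simp add: \<delta>_def)
  have "open S" "convex S"
    unfolding S_def by (auto intro!: convex_Int open_Int open_halfspace_Im_gt open_halfspace_Im_lt
        convex_halfspace_Im_gt convex_halfspace_Im_lt)
  have real_S: "complex_of_real a \<in> S" for a using \<open>\<delta> > 0\<close> by (simp add: S_def)
  \<comment> \<open>The squared distance from \<open>p + z *\<^sub>R v\<close> to \<open>q\<close>, as a polynomial in \<open>z\<close>.\<close>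
  define R :: "real ^ 'n \<Rightarrow> complex \<Rightarrow> complex" where
    "R q z = of_real ((norm (p - q))\<^sup>2) + 2 * z * of_real ((p - q) \<bullet> v) + z\<^sup>2 * of_real ((norm v)\<^sup>2)"
    for q z
  have sq: "(norm (u + a *\<^sub>R v))\<^sup>2 = (norm u)\<^sup>2 + 2 * a * (u \<bullet> v) + a\<^sup>2 * (norm v)\<^sup>2" for u a
    unfolding power2_norm_eq_inner
    by (simp add: inner_left_distrib inner_right_distrib inner_commute power2_eq_square algebra_simps)
  have R_real: "R q (of_real a) = of_real ((norm (p - q + a *\<^sub>R v))\<^sup>2)" for q a
    unfolding sq by (simp add: R_def)
  have Re_R: "Re (R q z) = (norm (p - q + Re z *\<^sub>R v))\<^sup>2 - (Im z)\<^sup>2 * (norm v)\<^sup>2" for q z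
    unfolding sq by (simp add: R_def Re_power2 algebra_simps)
  have R_pos: "R q z \<notin> \<real>\<^sub>\<le>\<^sub>0" if "q \<in> ?Q" "z \<in> S" for q z
  proof -
    have "\<bar>Im z\<bar> * norm v < sqrt \<epsilon>"
    proof -
      have "\<bar>Im z\<bar> < sqrt \<epsilon> / norm v"
        using that(2) by (auto simp: S_def \<delta>_def abs_less_iff)
      then show ?thesis using \<open>v \<noteq> 0\<close> by (simp add: pos_less_divide_eq)
    qed
    then have "(\<bar>Im z\<bar> * norm v)\<^sup>2 < (sqrt \<epsilon>)\<^sup>2"
      by (intro power_strict_mono) auto
    then have "(Im z)\<^sup>2 * (norm v)\<^sup>2 < \<epsilon>"
      using \<epsilon>(1) by (simp add: power_mult_distrib)
    then have "Re (R q z) > 0"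
      unfolding Re_R using e(2)[OF that(1), of "Re z"] \<epsilon>(2)[OF that(1)] by linarith
    then show ?thesis by (auto simp: complex_nonpos_Reals_iff)
  qed
  define c where "c = norm v powr - real ?d * (v \<bullet> w p)"
  define G where "G z = of_real c + z ^ (?d - 1) *
      (\<Sum>q\<in>?Q. (of_real ((p - q) \<bullet> w q) + z * of_real (v \<bullet> w q)) *
        R q z powr of_real (- real ?d / 2))" for z
  have "G holomorphic_on S"
    unfolding G_def
    by (intro holomorphic_intros R_pos) (auto simp: R_def[abs_def] intro!: holomorphic_intros)
  have G_real: "G (of_real a) = 0" if "a > 0" "p + a *\<^sub>R v \<in> U" for a
  proof -
    have summand: "dipole (p + a *\<^sub>R v - q) \<bullet> w q =
        norm (p - q + a *\<^sub>R v) powr - real ?d * ((p - q) \<bullet> w q + a * (v \<bullet> w q))" for q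
      by (simp add: dipole_def inner_left_distrib inner_diff_left algebra_simps)
    have pw: "(complex_of_real ((norm y)\<^sup>2)) powr of_real (- real ?d / 2) =
        of_real (norm y powr - real ?d)" for y :: "real ^ 'n"
      by (subst powr_of_real) (auto simp flip: powr_numeral simp: powr_powr)
    have "0 = a ^ (?d - 1) * (\<Sum>q\<in>P. dipole (p + a *\<^sub>R v - q) \<bullet> w q)"
      using zero[OF that(2)] by simp
    also have "\<dots> = a ^ (?d - 1) * (dipole (a *\<^sub>R v) \<bullet> w p) +
        a ^ (?d - 1) * (\<Sum>q\<in>?Q. dipole (p + a *\<^sub>R v - q) \<bullet> w q)"
      using \<open>finite P\<close> \<open>p \<in> P\<close> by (subst sum.remove[of P p]) (auto simp: algebra_simps)
    also have "a ^ (?d - 1) * (dipole (a *\<^sub>R v) \<bullet> w p) = c"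
    proof -
      have "a ^ (?d - 1) * a = a ^ ?d"
        by (rule power_minus_mult) simp
      moreover have "a powr - real ?d * a ^ ?d = 1"
        using \<open>a > 0\<close> by (simp add: powr_minus powr_realpow)
      ultimately have "(a ^ (?d - 1) * a) * a powr - real ?d = 1" by (metis mult.commute)
      then show ?thesis
        using \<open>a > 0\<close> by (simp add: dipole_def c_def powr_mult algebra_simps)
    qed
    finally have "0 = complex_of_real (c + a ^ (?d - 1) *
        (\<Sum>q\<in>?Q. dipole (p + a *\<^sub>R v - q) \<bullet> w q))"
      by simp
    also have "\<dots> = G (of_real a)"
      unfolding G_def R_real pw summand
      by (simp only: of_real_add of_real_mult of_real_power of_real_sum mult.commute)
    finally show ?thesis by simp
  qed
  obtain \<eta> where \<eta>: "\<eta> > 0" "ball x0 \<eta> \<subseteq> U"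
    using \<open>open U\<close> x0(1) open_contains_ball by blast
  \<comment> \<open>The line reaches \<open>x0\<close>, a point of \<open>U\<close>, at parameter 1.\<close>
  define Z where "Z = complex_of_real ` {1<..<1 + \<eta> / norm v}"
  have "1 islimpt Z"
  proof -
    have "\<eta> / norm v > 0" using \<eta>(1) \<open>v \<noteq> 0\<close> by simp
    then have "1 islimpt {1<..<1 + \<eta> / norm v}"
      by (intro islimpt_greaterThanLessThan1) simp
    then have "complex_of_real 1 islimpt Z"
      unfolding Z_def by (subst islimpt_isCont_image) (auto simp: eventually_at_filter)
    then show ?thesis by simp
  qed
  have "G z = 0" if "z \<in> Z" for z
  proof -
    from that obtain a where a: "z = of_real a" "1 < a" "a < 1 + \<eta> / norm v"
      by (auto simp: Z_def)
    have "dist x0 (p + a *\<^sub>R v) = (a - 1) * norm v"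
    proof -
      have "p + a *\<^sub>R v - x0 = (a - 1) *\<^sub>R v" by (simp add: v_def algebra_simps)
      then show ?thesis using a by (simp add: dist_norm norm_minus_commute[of x0])
    qed
    also have "\<dots> < \<eta>" using a \<open>v \<noteq> 0\<close> by (simp add: field_simps)
    finally show ?thesis using \<eta>(2) a by (auto intro!: G_real)
  qed
  then have "G 0 = 0"
    using analytic_continuation[OF \<open>G holomorphic_on S\<close> \<open>open S\<close> convex_connected[OF \<open>convex S\<close>],
        of Z 1 0] real_S real_S[of 0] real_S[of 1] \<open>1 islimpt Z\<close>
    by (auto simp: Z_def)
  then have "c = 0"
    using card by (simp add: G_def zero_power)
  then show False
    using x0(2) \<open>v \<noteq> 0\<close> by (simp add: c_def v_def[symmetric] inner_commute)
qed

section \<open>The potential outside the support\<close>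

text \<open>
  The complement of the support is a union of possibly uncountably many null-field open sets; the
  Lindelof property reduces it to countably many.
\<close>

lemma AE_zero_off_ess_support:
  fixes f :: "real ^ 'n \<Rightarrow> real ^ 'n"
  shows "AE x in lebesgue. x \<notin> ess_support f \<longrightarrow> f x = 0"
proof -
  let ?F = "{U. open U \<and> (AE x in lebesgue. x \<in> U \<longrightarrow> f x = 0)}"
  obtain F where F: "F \<subseteq> ?F" "countable F" "\<Union>F = \<Union>?F"
    using Lindelof[of ?F] by blast
  have "AE x in lebesgue. \<forall>U\<in>F. x \<in> U \<longrightarrow> f x = 0"
    using F(1,2) by (subst AE_ball_countable) auto
  then show ?thesis
    by eventually_elim (use F(3) in \<open>auto simp: ess_support_def\<close>)
qed

lemma sphere_area_pos: "d > 0 \<Longrightarrow> sphere_area d > 0"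
  by (simp add: sphere_area_def Gamma_real_pos)

text \<open>
  Passing to a Borel representative \<open>H\<close> and to \<open>lborel\<close> makes translation invariance
  available for the integral.
\<close>

lemma magnetic_potential_eq_dipole:
  fixes f :: "real ^ 'n \<Rightarrow> real ^ 'n"
  assumes card: "CARD('n) \<ge> 3" and "open \<Omega>"
    and off: "AE y in lebesgue. y \<notin> \<Omega> \<longrightarrow> f y = 0"
    and fH: "AE y in lebesgue. f y = H y" and [measurable]: "H \<in> borel_measurable borel"
  shows "magnetic_potential \<Omega> f x =
    - (LINT y|lborel. dipole (x - y) \<bullet> H y) / sphere_area CARD('n)"
proof -
  let ?F = "\<lambda>y. - (dipole (x - y) \<bullet> H y) / sphere_area CARD('n)"
  let ?G = "\<lambda>y. indicator \<Omega> y *\<^sub>R (gradient newton_kernel (x - y) \<bullet> f y)"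
  have meas: "?F \<in> borel_measurable borel" by measurable
  have "AE y in lborel. y \<noteq> x" by (rule AE_lborel_singleton)
  then have "AE y in lebesgue. y \<noteq> x" by (rule AE_completion)
  with off fH have ae: "AE y in lebesgue. ?F y = ?G y"
  proof eventually_elim
    case (elim y)
    then have "gradient newton_kernel (x - y) =
        (- (norm (x - y) powr - real CARD('n) / sphere_area CARD('n))) *\<^sub>R (x - y)"
      by (intro gradient_newton_kernel card) auto
    then show ?case
      using elim by (cases "y \<in> \<Omega>") (auto simp: dipole_def)
  qed
  have "magnetic_potential \<Omega> f x = (LINT y|lebesgue. ?G y)"
    unfolding magnetic_potential_def
    using \<open>open \<Omega>\<close> by (intro integral_restrict_space) (auto intro: sets_completionI_sets)
  also have "\<dots> = (LINT y|lebesgue. ?F y)"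
  proof (rule integral_cong_AE)
    show "?F \<in> borel_measurable lebesgue" using meas by (intro measurable_completion) simp
    then show "?G \<in> borel_measurable lebesgue" using ae by (rule borel_measurable_AE)
    show "AE y in lebesgue. ?G y = ?F y" using ae by eventually_elim simp
  qed
  also have "\<dots> = (LINT y|lborel. ?F y)"
    using meas by (intro integral_completion) simp
  finally show ?thesis by simp
qed

text \<open>
  The singularity of the kernel at \<open>x\<close> is harmless because \<open>H\<close> vanishes near \<open>x\<close>; elsewhere the
  kernel is at most \<open>r powr (1 - d)\<close>.
\<close>

lemma integrable_dipole_inner:
  fixes H :: "real ^ 'n \<Rightarrow> real ^ 'n"
  assumes [measurable]: "H \<in> borel_measurable borel" and "r > 0"
    and near: "AE y in lborel. y \<in> ball x r \<longrightarrow> H y = 0"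
    and "bounded B" and far: "AE y in lborel. y \<notin> B \<longrightarrow> H y = 0"
    and bound: "AE y in lborel. norm (H y) \<le> M"
  shows "integrable lborel (\<lambda>y. dipole (x - y) \<bullet> H y)"
proof -
  obtain R where R: "B \<subseteq> cball 0 R" using \<open>bounded B\<close> by (auto simp: bounded_iff subset_iff)
  have M: "M \<ge> 0"
  proof -
    obtain y where "norm (H y) \<le> M"
      using eventually_happens'[OF _ bound] by (auto simp: ae_filter_eq_bot_iff)
    then show ?thesis using norm_ge_zero order_trans by blast
  qed
  show ?thesis
  proof (rule integrableI_bounded_set[where A = "cball 0 R"])
    show "emeasure lborel (cball (0 :: real ^ 'n) R) < \<infinity>"
      by (rule emeasure_lborel_cball_finite)
    show "AE y in lborel. y \<in> cball 0 R \<longrightarrow>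
        norm (dipole (x - y) \<bullet> H y) \<le> r powr (1 - real CARD('n)) * M"
      using near bound
    proof eventually_elim
      case (elim y)
      show ?case
      proof (cases "y \<in> ball x r")
        case True
        then show ?thesis using elim M by simp
      next
        case False
        then have "norm (x - y) \<ge> r" by (simp add: dist_norm)
        have "norm (dipole (x - y)) = norm (x - y) powr (1 - real CARD('n))"
          using \<open>norm (x - y) \<ge> r\<close> \<open>r > 0\<close>
          by (simp add: dipole_def powr_diff powr_minus divide_inverse)
        also have "\<dots> \<le> r powr (1 - real CARD('n))"
          using \<open>norm (x - y) \<ge> r\<close> \<open>r > 0\<close> by (intro powr_mono2') (auto simp: Suc_leI)
        finally have "norm (dipole (x - y)) * norm (H y) \<le> r powr (1 - real CARD('n)) * M"
          using elim by (intro mult_mono) auto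
        then show ?thesis
          using Cauchy_Schwarz_ineq2[of "dipole (x - y)" "H y"] by simp
      qed
    qed
    show "AE y in lborel. y \<notin> cball 0 R \<longrightarrow> dipole (x - y) \<bullet> H y = 0"
      using far by eventually_elim (use R in auto)
  qed auto
qed

lemma box_simple_bounded:
  fixes f :: "real ^ 'n \<Rightarrow> real ^ 'n"
  assumes "box_simple f"
  obtains B M where "bounded B" "AE y in lebesgue. y \<notin> B \<longrightarrow> f y = 0"
    "AE y in lebesgue. norm (f y) \<le> M"
proof -
  obtain N :: nat and v a b
    where f: "AE y in lebesgue. f y = (\<Sum>i<N. indicat_real (cbox (a i) (b i)) y *\<^sub>R v i)"
    using assms unfolding box_simple_def by blast
  show ?thesis
  proof
    show "bounded (\<Union>i\<in>{..<N}. cbox (a i) (b i))" by (auto intro: bounded_UN bounded_cbox)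
    show "AE y in lebesgue. y \<notin> (\<Union>i\<in>{..<N}. cbox (a i) (b i)) \<longrightarrow> f y = 0"
      using f
    proof eventually_elim
      case (elim y)
      show ?case unfolding elim by (auto intro!: sum.neutral simp: indicator_def)
    qed
    show "AE y in lebesgue. norm (f y) \<le> (\<Sum>i<N. norm (v i))"
      using f
    proof eventually_elim
      case (elim y)
      show ?case unfolding elim by (intro sum_norm_le) (simp add: indicator_def)
    qed
  qed
qed

text \<open>
  The rigorous form of the statement that the mixed derivative of the potential is a sum of
  dipole potentials at the corners. The limit depends on the values of the potential near \<open>x\<close> only.
\<close>

lemma potential_mixed_difference_tendsto:
  fixes f :: "real ^ 'n \<Rightarrow> real ^ 'n"
  assumes card: "CARD('n) \<ge> 3" and f: "box_simple f" and "open \<Omega>" and "ess_support f \<subseteq> \<Omega>"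
    and "finite P" and fP: "AE y in lebesgue. f y = corner_sum P w y"
    and x: "x \<in> exterior_of \<Omega>" "x \<notin> P"
  shows "((\<lambda>s. (\<Sum>X\<in>UNIV. (-1) ^ card X * magnetic_potential \<Omega> f (x + corner (vec s) 0 X)) /
      s ^ CARD('n)) \<longlongrightarrow> - (\<Sum>p\<in>P. dipole (x - p) \<bullet> w p) / sphere_area CARD('n)) (at_right 0)"
proof -
  let ?H = "corner_sum P w"
  have off: "AE y in lebesgue. y \<notin> \<Omega> \<longrightarrow> f y = 0"
    using AE_zero_off_ess_support[of f] by eventually_elim (use assms(4) in auto)
  have pot: "magnetic_potential \<Omega> f z =
      - (LINT y|lborel. dipole (z - y) \<bullet> ?H y) / sphere_area CARD('n)" for z
    using magnetic_potential_eq_dipole[OF card \<open>open \<Omega>\<close> off fP] by simp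
  obtain B M where B: "bounded B" "AE y in lebesgue. y \<notin> B \<longrightarrow> f y = 0"
    and M: "AE y in lebesgue. norm (f y) \<le> M"
    using box_simple_bounded[OF f] .
  have "open (exterior_of \<Omega>)" by (simp add: exterior_of_def open_Compl)
  have int: "integrable lborel (\<lambda>y. dipole (x' - y) \<bullet> ?H y)" if "x' \<in> exterior_of \<Omega>" for x'
  proof -
    obtain r' where r': "r' > 0" "ball x' r' \<subseteq> exterior_of \<Omega>"
      using \<open>open (exterior_of \<Omega>)\<close> \<open>x' \<in> exterior_of \<Omega>\<close> open_contains_ball by blast
    have disj: "y \<notin> \<Omega>" if "y \<in> ball x' r'" for y
      using that r' closure_subset by (force simp: exterior_of_def)
    have "AE y in lebesgue. y \<in> ball x' r' \<longrightarrow> ?H y = 0"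
      using off fP by eventually_elim (use disj in auto)
    moreover have "AE y in lebesgue. y \<notin> B \<longrightarrow> ?H y = 0"
      using B(2) fP by eventually_elim auto
    moreover have "AE y in lebesgue. norm (?H y) \<le> M"
      using M fP by eventually_elim auto
    ultimately show ?thesis
      using r'(1) B(1) by (intro integrable_dipole_inner) (auto simp: AE_completion_iff)
  qed
  have \<sigma>: "sphere_area CARD('n) \<noteq> 0" using sphere_area_pos[of "CARD('n)"] by simp
  obtain r where r: "r > 0" "ball x r \<subseteq> exterior_of \<Omega>"
    using \<open>open (exterior_of \<Omega>)\<close> x(1) open_contains_ball by blast
  have "((\<lambda>s. - ((\<Sum>X\<in>UNIV. (-1) ^ card X *
      (LINT y|lborel. dipole (x + corner (vec s) 0 X - y) \<bullet> ?H y)) / s ^ CARD('n)) / sphere_area CARD('n))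
    \<longlongrightarrow> - (\<Sum>p\<in>P. dipole (x - p) \<bullet> w p) / sphere_area CARD('n)) (at_right 0)"
    using r int
    by (intro tendsto_intros mixed_difference_quotient_tendsto[where r = r] \<open>finite P\<close> x(2) \<sigma>) auto
  moreover have "- ((\<Sum>X\<in>UNIV. (-1) ^ card X *
      (LINT y|lborel. dipole (x + corner (vec s) 0 X - y) \<bullet> ?H y)) / s ^ CARD('n)) / sphere_area CARD('n) =
      (\<Sum>X\<in>UNIV. (-1) ^ card X * magnetic_potential \<Omega> f (x + corner (vec s) 0 X)) / s ^ CARD('n)" for s
    unfolding pot by (simp add: sum_divide_distrib sum_negf mult.commute)
  ultimately show ?thesis by simp
qed

section \<open>Uniqueness of box-simple fields\<close>

theorem corollary4p5:
  fixes f g :: "real ^ 'n \<Rightarrow> real ^ 'n"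
    and \<Omega> :: "(real ^ 'n) set"
  assumes "CARD('n) \<ge> 3"
    and "box_simple f"
    and "box_simple g"
    and "open \<Omega>"
    and "exterior_of \<Omega> \<noteq> {}"
    and "ess_support f \<subseteq> \<Omega>"
    and "ess_support g \<subseteq> \<Omega>"
    and "\<forall>x\<in>exterior_of \<Omega>. magnetic_potential \<Omega> f x = magnetic_potential \<Omega> g x"
  shows "AE x in lebesgue. f x = g x"
proof -
  obtain P\<^sub>f w\<^sub>f where Pf: "finite P\<^sub>f" "\<And>p. p \<notin> P\<^sub>f \<Longrightarrow> w\<^sub>f p = 0"
      "AE y in lebesgue. f y = corner_sum P\<^sub>f w\<^sub>f y"
    using box_simple_corner_sum[OF \<open>box_simple f\<close>] by metis
  obtain P\<^sub>g w\<^sub>g where Pg: "finite P\<^sub>g" "\<And>p. p \<notin> P\<^sub>g \<Longrightarrow> w\<^sub>g p = 0"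
      "AE y in lebesgue. g y = corner_sum P\<^sub>g w\<^sub>g y"
    using box_simple_corner_sum[OF \<open>box_simple g\<close>] by metis
  define P where "P = P\<^sub>f \<union> P\<^sub>g"
  have "finite P" using Pf(1) Pg(1) by (simp add: P_def)
  have "corner_sum P\<^sub>f w\<^sub>f = corner_sum P w\<^sub>f" "corner_sum P\<^sub>g w\<^sub>g = corner_sum P w\<^sub>g"
    unfolding corner_sum_def[abs_def] using Pf(2) Pg(2) \<open>finite P\<close>
    by (auto simp: P_def intro!: ext sum.mono_neutral_left)
  then have f: "AE y in lebesgue. f y = corner_sum P w\<^sub>f y"
    and g: "AE y in lebesgue. g y = corner_sum P w\<^sub>g y"
    using Pf(3) Pg(3) by simp_all
  let ?E = "exterior_of \<Omega>"
  have "open ?E" by (simp add: exterior_of_def open_Compl)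
  have \<sigma>: "sphere_area CARD('n) > 0" by (simp add: sphere_area_pos)
  have eq: "(\<Sum>p\<in>P. dipole (x - p) \<bullet> w\<^sub>f p) = (\<Sum>p\<in>P. dipole (x - p) \<bullet> w\<^sub>g p)"
    if x: "x \<in> ?E" "x \<notin> P" for x
  proof -
    let ?D = "\<lambda>h s. (\<Sum>X\<in>UNIV. (-1) ^ card X *
      magnetic_potential \<Omega> h (x + corner (vec s) 0 X)) / s ^ CARD('n)"
    obtain r where r: "r > 0" "ball x r \<subseteq> ?E"
      using \<open>open ?E\<close> x(1) open_contains_ball by blast
    from shifted_corners_in_ball[OF r(1), of x]
    have "\<forall>\<^sub>F s in at_right 0. ?D f s = ?D g s"
      by eventually_elim (use r(2) assms(8) in \<open>simp add: subset_iff\<close>)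
    with potential_mixed_difference_tendsto[OF assms(1,2,4,6) \<open>finite P\<close> f x]
    have "(?D g \<longlongrightarrow> - (\<Sum>p\<in>P. dipole (x - p) \<bullet> w\<^sub>f p) / sphere_area CARD('n)) (at_right 0)"
      by (rule Lim_transform_eventually)
    from tendsto_unique[OF _ this
        potential_mixed_difference_tendsto[OF assms(1,3,4,7) \<open>finite P\<close> g x]]
    have "- (\<Sum>p\<in>P. dipole (x - p) \<bullet> w\<^sub>f p) / sphere_area CARD('n) =
        - (\<Sum>p\<in>P. dipole (x - p) \<bullet> w\<^sub>g p) / sphere_area CARD('n)"
      by simp
    then show ?thesis using \<sigma> by simp
  qed
  have "open (?E - P)" using \<open>open ?E\<close> \<open>finite P\<close> by (intro open_Diff finite_imp_closed)
  moreover have "?E - P \<noteq> {}"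
    using open_not_negligible[OF \<open>open ?E\<close> assms(5)] negligible_finite[OF \<open>finite P\<close>]
      negligible_subset[of P ?E] by blast
  ultimately have "w\<^sub>f p - w\<^sub>g p = 0" if "p \<in> P" for p
    using assms(1) \<open>finite P\<close> that eq
    by (intro dipole_sum_eq_0_imp[of P "?E - P" "\<lambda>p. w\<^sub>f p - w\<^sub>g p"])
       (auto simp: inner_diff_right sum_subtractf)
  then have "corner_sum P w\<^sub>f = corner_sum P w\<^sub>g"
    by (auto simp: corner_sum_def intro!: ext sum.cong)
  with f g show ?thesis by (auto elim: eventually_elim2)
qed

end
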